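(* A cirquent (or formula) is provable in $\mathbf{CL5}$ if and only if it is trivial.
   Context: Formulas: built from infinitely many propositional atoms (no constants) using $\neg,\wedge,\vee$ (binary), $\neg$ only on atoms; $\neg\neg F$, $\neg(F\wedge G)$, $\neg(F\vee G)$ abbreviate $F$, $\neg F\vee\neg G$, $\neg F\wedge\neg G$. A $k$-ary cirquent is a pair consisting of a structure, i.e. a finite sequence ($m\ge0$, repetitions allowed) of subsets of $\{1,\dots,k\}$ (ogroups), and a pool $\langle F_1,\dots,F_k\rangle$ of formulas (oformulas); ogroup $\Gamma$ contains $F_i$ for $i\in\Gamma$; a formula $F$ is identified with the cirquent $(\langle\{1\}\rangle,\langle F\rangle)$. Rules of $\mathbf{CL5}$: (A) axioms: the empty cirquent and $(\langle\{1,2\}\rangle,\langle\neg F,F\rangle)$; (M) mix: from $(\langle\Gamma_1..\Gamma_m\rangle,\langle F_1..F_k\rangle)$ and $(\langle\Delta_1..\Delta_n\rangle,\langle G_1..G_l\rangle)$ infer $(\langle\Gamma_1,..,\Gamma_m,\Delta_1+k,..,\Delta_n+k\rangle,\langle F_1,..,F_k,G_1,..,G_l\rangle)$, $\Delta+k=\{j+k:j\in\Delta\}$; (E) exchange: swap two adjacent oformulas (ogroups keep the same oformulas) or two adjacent ogroups; (W) weakening: add to an ogroup the index of an existing oformula, or insert a new formula anywhere in the pool; (D) duplication: replace an ogroup $\Gamma$ by adjacent $\Gamma,\Gamma$, or the reverse; ($\vee$) merge adjacent oformulas $F,G$ into $F\vee G$, contained in exactly the ogroups that contained $F$ or $G$;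 ($\wedge$) when for adjacent oformulas $F,G$ no ogroup contains both, every ogroup containing $F$ is immediately followed by an ogroup containing $G$, and every ogroup containing $G$ is immediately preceded by an ogroup containing $F$: replace each such pair of adjacent ogroups by their union, then merge $F,G$ into $F\wedge G$. Proofs are finite trees of cirquents, each node following from its children by a rule. Resources: a port is an atom $P$ (output) or $-P$ (input), $P$ its type; an interface is a finite sequence of ports, a situation a bit string of the same length; $\mathbf s\le\mathbf s'$ iff $\mathbf s(i)\le\mathbf s'(i)$ at outputs and $\mathbf s'(i)\le\mathbf s(i)$ at inputs; a resource is an interface with a $\le$-monotone function from situations to $\{0,1\}$ (1 = true). For a cirquent $C$: a situation assigns truth values to all atom occurrences in its oformulas; oformulas are evaluated by classical clauses on occurrences ($\neg P$ true iff that occurrence of $P$ false), groups by disjunction, $C$ by conjunction of its groups. $C^\clubsuit$ has interface $\langle\mathrm{Port}(L_1),\dots,\mathrm{Port}(L_n)\rangle$ ($L_i$ the literal occurrences of $C$ in order; $\mathrm{Port}(P)=P$, $\mathrm{Port}(\neg P)=-P$) and is true in $\mathbf s$ iff $C$ is. An allocation for a resource is a pair $(X,Y)$ of an input occurrence $X$ and an output occurrence $Y$ of its interface of the same type; an arrangement is a set of allocations, monogamous iff no port occurrence is in more than one allocation. A situation is consistent with $\mathcal A$ iff $\mathbf s(X)\le\mathbf s(Y)$ for all $(X,Y)\in\mathcal A$; $\mathcal A$ is trivializing iff the resource is true in all situations consistent with $\mathcal A$. A resource is trivial iff it has a monogamous trivializing arrangement; a cirquent or formula $C$ is trivial iff $C^\clubsuit$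 is. *)

theory Defs
  imports Main "HOL-Combinatorics.Transposition"
begin

section \<open>Formulas and cirquents\<close>

datatype 'a lit = Pos 'a | Neg 'a

datatype 'a form = Lit "'a lit" | Conj "'a form" "'a form" | Disj "'a form" "'a form"

fun neg_lit :: "'a lit \<Rightarrow> 'a lit" where
  "neg_lit (Pos P) = Neg P"
| "neg_lit (Neg P) = Pos P"

fun neg :: "'a form \<Rightarrow> 'a form" where
  "neg (Lit L) = Lit (neg_lit L)"
| "neg (Conj F G) = Disj (neg F) (neg G)"
| "neg (Disj F G) = Conj (neg F) (neg G)"

text \<open>A cirquent is a pair (structure, pool). Positions in the pool are numbered from 0, as is
  usual for lists, so the ogroups of a \<open>k\<close>-ary cirquent are subsets of \<open>{..<k}\<close>.\<close>

type_synonym 'a cirquent = "nat set list \<times> 'a form list"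

definition is_cirquent :: "'a cirquent \<Rightarrow> bool" where
  "is_cirquent C \<longleftrightarrow> (\<forall>\<Gamma> \<in> set (fst C). \<Gamma> \<subseteq> {..<length (snd C)})"

definition form_cirquent :: "'a form \<Rightarrow> 'a cirquent" where
  "form_cirquent F = ([{0}], [F])"


section \<open>The calculus\<close>

text \<open>Renumbering of pool positions when a formula is inserted at position \<open>i\<close>, and when the
  formulas at positions \<open>i\<close> and \<open>i + 1\<close> are merged into one.\<close>

definition ins_pos :: "nat \<Rightarrow> nat \<Rightarrow> nat" where
  "ins_pos i j = (if j < i then j else Suc j)"

definition merge_pos :: "nat \<Rightarrow> nat \<Rightarrow> nat" where
  "merge_pos i j = (if j \<le> i then j else j - 1)"

definition conj_ready :: "nat \<Rightarrow> nat set list \<Rightarrow> bool" where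
  "conj_ready i S \<longleftrightarrow>
     (\<forall>n < length S. \<not> (i \<in> S ! n \<and> Suc i \<in> S ! n)) \<and>
     (\<forall>n < length S. i \<in> S ! n \<longrightarrow> Suc n < length S \<and> Suc i \<in> S ! Suc n) \<and>
     (\<forall>n < length S. Suc i \<in> S ! n \<longrightarrow> 0 < n \<and> i \<in> S ! (n - 1))"

text \<open>For a structure satisfying \<open>conj_ready i\<close>, the adjacent pairs to be united are exactly those
  whose first ogroup contains \<open>i\<close>, and these pairs do not overlap.\<close>

fun unite_pairs :: "nat \<Rightarrow> nat set list \<Rightarrow> nat set list" where
  "unite_pairs i [] = []"
| "unite_pairs i [\<Gamma>] = [\<Gamma>]"
| "unite_pairs i (\<Gamma> # \<Delta> # S) =
     (if i \<in> \<Gamma> then (\<Gamma> \<union> \<Delta>) # unite_pairs i S else \<Gamma> # unite_pairs i (\<Delta> # S))"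

inductive CL5 :: "'a cirquent \<Rightarrow> bool" where
  ax_empty: "CL5 ([], [])"
| ax_id: "CL5 ([{0, 1}], [neg F, F])"
| mix: "CL5 (S, Fs) \<Longrightarrow> CL5 (T, Gs) \<Longrightarrow>
    CL5 (S @ map (image (\<lambda>j. j + length Fs)) T, Fs @ Gs)"
| pool_exchange: "CL5 (S, Fs @ F # G # Gs) \<Longrightarrow>
    CL5 (map (image (transpose (length Fs) (Suc (length Fs)))) S, Fs @ G # F # Gs)"
| group_exchange: "CL5 (S @ \<Gamma> # \<Delta> # T, Fs) \<Longrightarrow> CL5 (S @ \<Delta> # \<Gamma> # T, Fs)"
| group_weakening: "CL5 (S @ \<Gamma> # T, Fs) \<Longrightarrow> i < length Fs \<Longrightarrow> CL5 (S @ insert i \<Gamma> # T, Fs)"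
| pool_weakening: "CL5 (S, Fs @ Gs) \<Longrightarrow>
    CL5 (map (image (ins_pos (length Fs))) S, Fs @ F # Gs)"
| duplication_down: "CL5 (S @ \<Gamma> # T, Fs) \<Longrightarrow> CL5 (S @ \<Gamma> # \<Gamma> # T, Fs)"
| duplication_up: "CL5 (S @ \<Gamma> # \<Gamma> # T, Fs) \<Longrightarrow> CL5 (S @ \<Gamma> # T, Fs)"
| disj_intro: "CL5 (S, Fs @ F # G # Gs) \<Longrightarrow>
    CL5 (map (image (merge_pos (length Fs))) S, Fs @ Disj F G # Gs)"
| conj_intro: "CL5 (S, Fs @ F # G # Gs) \<Longrightarrow> conj_ready (length Fs) S \<Longrightarrow>
    CL5 (map (image (merge_pos (length Fs))) (unite_pairs (length Fs) S), Fs @ Conj F G # Gs)"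


section \<open>Resources\<close>

datatype 'a port = Output 'a | Input 'a

type_synonym 'a interface = "'a port list"

type_synonym situation = "bool list"

definition is_situation :: "'a interface \<Rightarrow> situation \<Rightarrow> bool" where
  "is_situation I s \<longleftrightarrow> length s = length I"

definition situation_le :: "'a interface \<Rightarrow> situation \<Rightarrow> situation \<Rightarrow> bool" where
  "situation_le I s s' \<longleftrightarrow>
     (\<forall>i < length I. case I ! i of Output _ \<Rightarrow> s ! i \<le> s' ! i | Input _ \<Rightarrow> s' ! i \<le> s ! i)"

type_synonym 'a resource = "'a interface \<times> (situation \<Rightarrow> bool)"

definition is_resource :: "'a resource \<Rightarrow> bool" where
  "is_resource R \<longleftrightarrow>
     (\<forall>s s'. is_situation (fst R) s \<longrightarrow> is_situation (fst R) s' \<longrightarrow> situation_le (fst R) s s' \<longrightarrow>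
        snd R s \<le> snd R s')"

text \<open>Port occurrences are positions in the interface; an allocation is a pair
  (input occurrence, output occurrence).\<close>

definition is_allocation :: "'a resource \<Rightarrow> nat \<times> nat \<Rightarrow> bool" where
  "is_allocation R a \<longleftrightarrow>
     fst a < length (fst R) \<and> snd a < length (fst R) \<and>
     (\<exists>P. fst R ! fst a = Input P \<and> fst R ! snd a = Output P)"

definition is_arrangement :: "'a resource \<Rightarrow> (nat \<times> nat) set \<Rightarrow> bool" where
  "is_arrangement R A \<longleftrightarrow> (\<forall>a \<in> A. is_allocation R a)"

definition monogamous :: "(nat \<times> nat) set \<Rightarrow> bool" where
  "monogamous A \<longleftrightarrow>
     (\<forall>p. \<forall>a \<in> A. \<forall>b \<in> A. p \<in> {fst a, snd a} \<longrightarrow> p \<in> {fst b, snd b} \<longrightarrow> a = b)"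

definition consistent :: "situation \<Rightarrow> (nat \<times> nat) set \<Rightarrow> bool" where
  "consistent s A \<longleftrightarrow> (\<forall>(x, y) \<in> A. s ! x \<le> s ! y)"

definition trivializing :: "'a resource \<Rightarrow> (nat \<times> nat) set \<Rightarrow> bool" where
  "trivializing R A \<longleftrightarrow> (\<forall>s. is_situation (fst R) s \<longrightarrow> consistent s A \<longrightarrow> snd R s)"

definition trivial_resource :: "'a resource \<Rightarrow> bool" where
  "trivial_resource R \<longleftrightarrow> (\<exists>A. is_arrangement R A \<and> monogamous A \<and> trivializing R A)"


section \<open>Cirquents as resources\<close>

fun form_lits :: "'a form \<Rightarrow> 'a lit list" where
  "form_lits (Lit L) = [L]"
| "form_lits (Conj F G) = form_lits F @ form_lits G"
| "form_lits (Disj F G) = form_lits F @ form_lits G"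

definition cirquent_lits :: "'a cirquent \<Rightarrow> 'a lit list" where
  "cirquent_lits C = concat (map form_lits (snd C))"

fun lit_port :: "'a lit \<Rightarrow> 'a port" where
  "lit_port (Pos P) = Output P"
| "lit_port (Neg P) = Input P"

text \<open>A situation for a cirquent lists the truth values of its atom occurrences from left to right.
  In \<open>form_true s n F\<close>, the number \<open>n\<close> is the position in \<open>s\<close> of the first atom occurrence
  of this occurrence of \<open>F\<close>.\<close>

fun form_true :: "situation \<Rightarrow> nat \<Rightarrow> 'a form \<Rightarrow> bool" where
  "form_true s n (Lit (Pos P)) = s ! n"
| "form_true s n (Lit (Neg P)) = (\<not> s ! n)"
| "form_true s n (Conj F G) = (form_true s n F \<and> form_true s (n + length (form_lits F)) G)"
| "form_true s n (Disj F G) = (form_true s n F \<or> form_true s (n + length (form_lits F)) G)"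

definition oform_true :: "situation \<Rightarrow> 'a form list \<Rightarrow> nat \<Rightarrow> bool" where
  "oform_true s Fs i = form_true s (length (concat (map form_lits (take i Fs)))) (Fs ! i)"

definition group_true :: "situation \<Rightarrow> 'a form list \<Rightarrow> nat set \<Rightarrow> bool" where
  "group_true s Fs \<Gamma> \<longleftrightarrow> (\<exists>i \<in> \<Gamma>. oform_true s Fs i)"

definition cirquent_true :: "situation \<Rightarrow> 'a cirquent \<Rightarrow> bool" where
  "cirquent_true s C \<longleftrightarrow> (\<forall>\<Gamma> \<in> set (fst C). group_true s (snd C) \<Gamma>)"

definition club :: "'a cirquent \<Rightarrow> 'a resource" where
  "club C = (map lit_port (cirquent_lits C), \<lambda>s. cirquent_true s C)"

definition trivial_cirquent :: "'a cirquent \<Rightarrow> bool" where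
  "trivial_cirquent C \<longleftrightarrow> trivial_resource (club C)"

lemma form_true_mono:
  assumes "form_true s n F"
    and "\<And>i. i < length (form_lits F) \<Longrightarrow>
      (case lit_port (form_lits F ! i) of Output _ \<Rightarrow> s ! (n + i) \<le> s' ! (n + i)
        | Input _ \<Rightarrow> s' ! (n + i) \<le> s ! (n + i))"
  shows "form_true s' n F"
  using assms
proof (induction F arbitrary: n)
  case (Lit L)
  from Lit.prems(1) Lit.prems(2)[of 0] show ?case by (cases L) auto
next
  case (Conj F G)
  have F: "form_true s n F \<Longrightarrow> form_true s' n F"
  proof (rule Conj.IH(1))
    fix i assume "i < length (form_lits F)"
    then show "case lit_port (form_lits F ! i) of Output _ \<Rightarrow> s ! (n + i) \<le> s' ! (n + i)
        | Input _ \<Rightarrow> s' ! (n + i) \<le> s ! (n + i)"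
      using Conj.prems(2)[of i] by (simp add: nth_append)
  qed
  have G: "form_true s (n + length (form_lits F)) G \<Longrightarrow> form_true s' (n + length (form_lits F)) G"
  proof (rule Conj.IH(2))
    fix i assume "i < length (form_lits G)"
    then show "case lit_port (form_lits G ! i) of
        Output _ \<Rightarrow> s ! (n + length (form_lits F) + i) \<le> s' ! (n + length (form_lits F) + i)
      | Input _ \<Rightarrow> s' ! (n + length (form_lits F) + i) \<le> s ! (n + length (form_lits F) + i)"
      using Conj.prems(2)[of "length (form_lits F) + i"] by (auto simp: nth_append add.assoc split: port.splits)
  qed
  show ?case using F G Conj.prems(1) by simp
next
  case (Disj F G)
  have F: "form_true s n F \<Longrightarrow> form_true s' n F"
  proof (rule Disj.IH(1))
    fix i assume "i < length (form_lits F)"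
    then show "case lit_port (form_lits F ! i) of Output _ \<Rightarrow> s ! (n + i) \<le> s' ! (n + i)
        | Input _ \<Rightarrow> s' ! (n + i) \<le> s ! (n + i)"
      using Disj.prems(2)[of i] by (simp add: nth_append)
  qed
  have G: "form_true s (n + length (form_lits F)) G \<Longrightarrow> form_true s' (n + length (form_lits F)) G"
  proof (rule Disj.IH(2))
    fix i assume "i < length (form_lits G)"
    then show "case lit_port (form_lits G ! i) of
        Output _ \<Rightarrow> s ! (n + length (form_lits F) + i) \<le> s' ! (n + length (form_lits F) + i)
      | Input _ \<Rightarrow> s' ! (n + length (form_lits F) + i) \<le> s ! (n + length (form_lits F) + i)"
      using Disj.prems(2)[of "length (form_lits F) + i"] by (auto simp: nth_append add.assoc split: port.splits)
  qed
  show ?case using F G Disj.prems(1) by auto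
qed

lemma is_resource_club:
  assumes "is_cirquent C"
  shows "is_resource (club C)"
proof -
  obtain S Fs where C: "C = (S, Fs)" by (cases C)
  let ?L = "concat (map form_lits Fs)"
  have "oform_true s' Fs j"
    if le: "situation_le (map lit_port ?L) s s'" and j: "j < length Fs" and t: "oform_true s Fs j"
    for s s' j
  proof -
    let ?n = "length (concat (map form_lits (take j Fs)))"
    have L: "?L = concat (map form_lits (take j Fs)) @ form_lits (Fs ! j) @
        concat (map form_lits (drop (Suc j) Fs))"
      using j by (subst id_take_nth_drop[OF j]) simp
    have "form_true s' ?n (Fs ! j)"
    proof (rule form_true_mono)
      show "form_true s ?n (Fs ! j)" using t by (simp add: oform_true_def)
    next
      fix i assume i: "i < length (form_lits (Fs ! j))"
      have "?L ! (?n + i) = form_lits (Fs ! j) ! i"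
        unfolding L using i by (simp add: nth_append del: length_concat)
      moreover have "?n + i < length ?L"
        unfolding L using i by (simp del: length_concat)
      ultimately show "case lit_port (form_lits (Fs ! j) ! i) of
          Output _ \<Rightarrow> s ! (?n + i) \<le> s' ! (?n + i) | Input _ \<Rightarrow> s' ! (?n + i) \<le> s ! (?n + i)"
        using le unfolding situation_le_def by (metis length_map nth_map)
    qed
    then show ?thesis by (simp add: oform_true_def)
  qed
  then show ?thesis
    using assms unfolding C is_resource_def club_def is_cirquent_def cirquent_true_def
      group_true_def cirquent_lits_def
    by (fastforce simp del: length_concat)
qed

end

theory Submission
  imports Defs "HOL-Library.Multiset"
begin

text \<open>Soundness: every provable cirquent becomes a classical tautology after its atom occurrences are
  relabelled so that each literal occurs at most once; pairing the two occurrences of each label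
  is then a trivializing monogamous arrangement. Completeness: read bottom-up, the rules for
  \<open>\<or>\<close> and \<open>\<and>\<close> can be applied without changing the resource until only literals
  remain. Then every ogroup must contain an allocation of the arrangement, and the cirquent is
  obtained from a mix of identity axioms, one for each allocation used.\<close>

section \<open>Soundness\<close>

text \<open>Triviality speaks of positions in an interface, and the pool rules renumber these. The
  soundness induction therefore runs on labelled pools: apart from the identity axiom, no rule
  inspects the atoms of an oformula, so labels travel from premise to conclusion. Labels have to be
  chosen only for an axiom, for the second pool of a mix and for an oformula added by weakening; the
  rest is classical reasoning about disjunctions. A label may occur in one polarity only, because
  weakening adds unmatched literals. Completeness rests on sharing: an ogroup containing F \<and> G
  splits into two ogroups that refer to the same remaining oformulas, so no occurrence is copied and
  the old arrangement still serves. For literals, the mixed identity axioms come with their own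
  order of pool and ogroups, without unmatched literals and without repeated or larger ogroups.
  Exchange, weakening and duplication bridge this gap.\<close>

fun eval_form :: "('b \<Rightarrow> bool) \<Rightarrow> 'b form \<Rightarrow> bool" where
  "eval_form v (Lit (Pos P)) = v P"
| "eval_form v (Lit (Neg P)) = (\<not> v P)"
| "eval_form v (Conj F G) = (eval_form v F \<and> eval_form v G)"
| "eval_form v (Disj F G) = (eval_form v F \<or> eval_form v G)"

text \<open>The labelled atoms \<open>(P, k)\<close> of \<open>Gs\<close> stand for the atom \<open>P\<close>; distinctness says that each of
  them occurs at most once positively and at most once negatively.\<close>

definition binary_tautology :: "'a cirquent \<Rightarrow> bool" where
  "binary_tautology C \<longleftrightarrow> is_cirquent C \<and>
     (\<exists>Gs :: ('a \<times> nat) form list. map (map_form fst) Gs = snd C \<and>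
        distinct (concat (map form_lits Gs)) \<and>
        (\<forall>v. \<forall>\<Gamma> \<in> set (fst C). \<exists>i \<in> \<Gamma>. eval_form v (Gs ! i)))"

lemma binary_tautologyE:
  assumes "binary_tautology (S, Fs :: 'a form list)"
  obtains Hs :: "('a \<times> nat) form list" where "map (map_form fst) Hs = Fs"
    "distinct (concat (map form_lits Hs))"
    "\<forall>v. \<forall>\<Gamma> \<in> set S. \<exists>i \<in> \<Gamma>. eval_form v (Hs ! i)" "is_cirquent (S, Fs)"
proof -
  from assms obtain Hs :: "('a \<times> nat) form list" where "is_cirquent (S, Fs)"
    "map (map_form fst) Hs = Fs" "distinct (concat (map form_lits Hs))"
    "\<forall>v. \<forall>\<Gamma> \<in> set S. \<exists>i \<in> \<Gamma>. eval_form v (Hs ! i)"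
    unfolding binary_tautology_def by auto
  then show thesis by (intro that[of Hs]) auto
qed

section \<open>Labelling of atom occurrences\<close>

fun lit_atom :: "'b lit \<Rightarrow> 'b" where
  "lit_atom (Pos P) = P"
| "lit_atom (Neg P) = P"

text \<open>The start value \<open>n\<close> serves two purposes: it numbers the occurrences
  consecutively through the recursion, and it allows a copy whose labels lie above all labels
  already in use.\<close>

fun label_form :: "nat \<Rightarrow> 'a form \<Rightarrow> ('a \<times> nat) form" where
  "label_form n (Lit L) = Lit (map_lit (\<lambda>P. (P, n)) L)"
| "label_form n (Conj F G) = Conj (label_form n F) (label_form (n + length (form_lits F)) G)"
| "label_form n (Disj F G) = Disj (label_form n F) (label_form (n + length (form_lits F)) G)"

lemma map_form_fst_label_form: "map_form fst (label_form n F) = F"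
  by (induction F arbitrary: n) (auto simp: lit.map_comp comp_def lit.map_ident)

lemma form_lits_map_form: "form_lits (map_form f F) = map (map_lit f) (form_lits F)"
  by (induction F) auto

lemma labels_label_form:
  "map (\<lambda>L. snd (lit_atom L)) (form_lits (label_form n F)) = [n..<n + length (form_lits F)]"
proof (induction F arbitrary: n)
  case (Lit L)
  then show ?case by (cases L) auto
next
  case (Conj F G)
  then show ?case by (simp add: upt_add_eq_append[symmetric] add.assoc[symmetric])
next
  case (Disj F G)
  then show ?case by (simp add: upt_add_eq_append[symmetric] add.assoc[symmetric])
qed

lemma distinct_labels_label_form:
  "distinct (map (\<lambda>L. snd (lit_atom L)) (form_lits (label_form n F)))"
  by (simp only: labels_label_form distinct_upt)

lemma label_ge:
  assumes "L \<in> set (form_lits (label_form n F))"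
  shows "n \<le> snd (lit_atom L)"
proof -
  have "snd (lit_atom L) \<in> set (map (\<lambda>L. snd (lit_atom L)) (form_lits (label_form n F)))"
    using assms by auto
  then show ?thesis unfolding labels_label_form by simp
qed

lemma form_lits_neg: "form_lits (neg F) = map neg_lit (form_lits F)"
  by (induction F) auto

lemma map_form_neg: "map_form f (neg F) = neg (map_form f F)"
proof (induction F)
  case (Lit L)
  then show ?case by (cases L) auto
qed auto

lemma eval_form_neg: "eval_form v (neg F) \<longleftrightarrow> \<not> eval_form v F"
proof (induction F)
  case (Lit L)
  then show ?case by (cases L) auto
qed auto

lemma eval_form_map: "eval_form v (map_form f F) = eval_form (v \<circ> f) F"
proof (induction F)
  case (Lit L)
  then show ?case by (cases L) auto
qed auto

lemma lit_atom_neg_lit: "lit_atom (neg_lit L) = lit_atom L"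
  by (cases L) auto

lemma neg_lit_neq: "neg_lit L \<noteq> L"
  by (cases L) auto

lemma inj_neg_lit: "inj neg_lit"
proof (rule injI)
  fix L M :: "'b lit" assume "neg_lit L = neg_lit M"
  then show "L = M" by (cases L; cases M) auto
qed

section \<open>Preservation of labelled tautologies by the rules\<close>

lemma binary_tautology_ax_id: "binary_tautology ([{0, 1}], [neg F, F])"
proof -
  let ?G = "label_form 0 F"
  have d: "distinct (form_lits ?G)"
    using distinct_labels_label_form[of 0 F] by (simp only: distinct_map)
  have inj: "inj_on (\<lambda>L. snd (lit_atom L)) (set (form_lits ?G))"
    using distinct_labels_label_form[of 0 F] by (simp only: distinct_map)
  \<comment> \<open>A literal and its negation carry the same label, and inside \<open>?G\<close> a
    label determines the literal. So \<open>?G\<close> and \<open>neg ?G\<close> have no literal in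
    common, although every label occurs in both.\<close>
  have "neg_lit L \<notin> set (form_lits ?G)" if "L \<in> set (form_lits ?G)" for L
    using inj_onD[OF inj, of "neg_lit L" L] that neg_lit_neq[of L] by (auto simp: lit_atom_neg_lit)
  then have "distinct (concat (map form_lits [neg ?G, ?G]))"
    using d by (auto simp: form_lits_neg distinct_map intro: inj_on_subset[OF inj_neg_lit])
  then show ?thesis
    unfolding binary_tautology_def
    by (intro conjI exI[of _ "[neg ?G, ?G]"])
      (auto simp: is_cirquent_def map_form_neg map_form_fst_label_form eval_form_neg)
qed

lemma finite_label_bound:
  "\<exists>N. \<forall>L \<in> set (Ls :: ('a \<times> nat) lit list). snd (lit_atom L) < N"
proof -
  have "finite ((\<lambda>L. snd (lit_atom L)) ` set Ls)" by simp
  then obtain N where "\<forall>k \<in> (\<lambda>L. snd (lit_atom L)) ` set Ls. k < N"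
    using finite_nat_set_iff_bounded by blast
  then show ?thesis by auto
qed

lemma binary_tautology_mix:
  assumes "binary_tautology (S, Fs)" "binary_tautology (T, Gs)"
  shows "binary_tautology (S @ map (image (\<lambda>j. j + length Fs)) T, Fs @ Gs)"
proof -
  obtain Fs' :: "('a \<times> nat) form list" where
    F: "map (map_form fst) Fs' = Fs" "distinct (concat (map form_lits Fs'))"
    "\<forall>v. \<forall>\<Gamma> \<in> set S. \<exists>i \<in> \<Gamma>. eval_form v (Fs' ! i)"
    and FC: "is_cirquent (S, Fs)"
    using assms(1) by (rule binary_tautologyE)
  obtain Gs' :: "('a \<times> nat) form list" where
    G: "map (map_form fst) Gs' = Gs" "distinct (concat (map form_lits Gs'))"
    "\<forall>v. \<forall>\<Gamma> \<in> set T. \<exists>i \<in> \<Gamma>. eval_form v (Gs' ! i)"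
    and GC: "is_cirquent (T, Gs)"
    using assms(2) by (rule binary_tautologyE)
  obtain N where N: "\<And>L. L \<in> set (concat (map form_lits Fs')) \<Longrightarrow> snd (lit_atom L) < N"
    using finite_label_bound[of "concat (map form_lits Fs')"] by auto
  \<comment> \<open>Shifting by \<open>N\<close> lifts the labels of the second premise above those
    of the first. The underlying atoms stay the same, and a valuation \<open>v\<close> of the
    shifted formulas is the valuation \<open>v \<circ> r\<close> of the original ones.\<close>
  define r where "r = (\<lambda>(a :: 'a, k). (a, k + N))"
  have r: "inj r" "fst \<circ> r = fst" by (auto simp: r_def inj_on_def)
  let ?Gs = "map (map_form r) Gs'"
  have lits: "concat (map form_lits ?Gs) = map (map_lit r) (concat (map form_lits Gs'))"
    by (induction Gs') (auto simp: form_lits_map_form)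
  have "N \<le> snd (lit_atom L)" if L: "L \<in> set (concat (map form_lits ?Gs))" for L
  proof -
    obtain M where "L = map_lit r M" using L unfolding lits set_map by blast
    then show ?thesis by (cases M) (auto simp: r_def)
  qed
  then have disj: "set (concat (map form_lits Fs')) \<inter> set (concat (map form_lits ?Gs)) = {}"
    using N by (meson disjoint_iff leD)
  have "distinct (concat (map form_lits ?Gs))"
    unfolding lits using G(2) lit.inj_map[OF r(1)] by (simp only: distinct_map) (blast intro: inj_on_subset)
  with disj F(2) have "distinct (concat (map form_lits (Fs' @ ?Gs)))"
    by (simp only: map_append concat_append distinct_append)
  moreover have "map (map_form fst) (Fs' @ ?Gs) = Fs @ Gs"
    using F(1) G(1) by (auto simp: form.map_comp r(2))
  moreover have "is_cirquent (S @ map (image (\<lambda>j. j + length Fs)) T, Fs @ Gs)"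
    using FC GC by (fastforce simp: is_cirquent_def)
  moreover have "\<exists>i \<in> \<Gamma>. eval_form v ((Fs' @ ?Gs) ! i)"
    if \<Gamma>: "\<Gamma> \<in> set (S @ map (image (\<lambda>j. j + length Fs)) T)" for v \<Gamma>
  proof (cases "\<Gamma> \<in> set S")
    case True
    then have "\<Gamma> \<subseteq> {..<length Fs'}" using FC F(1) unfolding is_cirquent_def by fastforce
    then show ?thesis using F(3)[rule_format, OF True, of v] by (auto simp: nth_append)
  next
    case False
    then obtain \<Delta> where \<Delta>: "\<Delta> \<in> set T" "\<Gamma> = (\<lambda>j. j + length Fs) ` \<Delta>" using \<Gamma> by auto
    obtain i where i: "i \<in> \<Delta>" "eval_form (v \<circ> r) (Gs' ! i)" using G(3)[rule_format, OF \<Delta>(1)] by blast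
    have "i < length Gs'" using i(1) \<Delta>(1) GC G(1) unfolding is_cirquent_def by fastforce
    then have "eval_form v ((Fs' @ ?Gs) ! (i + length Fs))"
      using i(2) F(1) by (auto simp: nth_append eval_form_map)
    then show ?thesis using i(1) \<Delta>(2) by blast
  qed
  ultimately show ?thesis
    unfolding binary_tautology_def by (intro conjI exI[of _ "Fs' @ ?Gs"]) auto
qed

lemma binary_tautology_pool_exchange:
  assumes "binary_tautology (S, Fs @ F # G # Gs)"
  shows "binary_tautology (map (image (transpose (length Fs) (Suc (length Fs)))) S, Fs @ G # F # Gs)"
proof -
  obtain Hs :: "('a \<times> nat) form list" where
    H: "map (map_form fst) Hs = Fs @ F # G # Gs" "distinct (concat (map form_lits Hs))"
    "\<forall>v. \<forall>\<Gamma> \<in> set S. \<exists>i \<in> \<Gamma>. eval_form v (Hs ! i)"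
    and C: "is_cirquent (S, Fs @ F # G # Gs)"
    using assms by (rule binary_tautologyE)
  obtain Fs' F' G' Gs' where Hs: "Hs = Fs' @ F' # G' # Gs'" and
    parts: "map (map_form fst) Fs' = Fs" "map_form fst F' = F" "map_form fst G' = G"
    "map (map_form fst) Gs' = Gs"
    using H(1) by (auto simp: map_eq_append_conv map_eq_Cons_conv)
  have len: "length Fs = length Fs'" using parts(1) by auto
  have nth: "(Fs' @ G' # F' # Gs') ! transpose (length Fs') (Suc (length Fs')) i = Hs ! i" for i
    by (auto simp: Hs transpose_def nth_append nth_Cons')
  have "distinct (concat (map form_lits (Fs' @ G' # F' # Gs')))"
    using H(2) unfolding Hs by auto
  moreover have "is_cirquent (map (image (transpose (length Fs) (Suc (length Fs)))) S, Fs @ G # F # Gs)"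
    using C by (fastforce simp: is_cirquent_def transpose_def)
  ultimately show ?thesis
    unfolding binary_tautology_def using H(3)[rule_format] parts
    by (intro conjI exI[of _ "Fs' @ G' # F' # Gs'"]) (auto simp: len nth)
qed

lemma binary_tautology_pool_weakening:
  assumes "binary_tautology (S, Fs @ Gs)"
  shows "binary_tautology (map (image (ins_pos (length Fs))) S, Fs @ F # Gs)"
proof -
  obtain Hs :: "('a \<times> nat) form list" where
    H: "map (map_form fst) Hs = Fs @ Gs" "distinct (concat (map form_lits Hs))"
    "\<forall>v. \<forall>\<Gamma> \<in> set S. \<exists>i \<in> \<Gamma>. eval_form v (Hs ! i)"
    and C: "is_cirquent (S, Fs @ Gs)"
    using assms by (rule binary_tautologyE)
  obtain Fs' Gs' where Hs: "Hs = Fs' @ Gs'" and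
    parts: "map (map_form fst) Fs' = Fs" "map (map_form fst) Gs' = Gs"
    using H(1) by (auto simp: map_eq_append_conv)
  have len: "length Fs = length Fs'" using parts(1) by auto
  obtain N where N: "\<And>L. L \<in> set (concat (map form_lits Hs)) \<Longrightarrow> snd (lit_atom L) < N"
    using finite_label_bound[of "concat (map form_lits Hs)"] by auto
  \<comment> \<open>No ogroup contains the new oformula, so its labels only have to avoid the old
    ones.\<close>
  let ?F = "label_form N F"
  have nth: "(Fs' @ ?F # Gs') ! ins_pos (length Fs') i = Hs ! i" for i
    by (auto simp: Hs ins_pos_def nth_append Suc_diff_le)
  have "set (form_lits ?F) \<inter> set (concat (map form_lits Hs)) = {}"
    using N label_ge[of _ N F] by (meson disjoint_iff leD)
  then have "distinct (concat (map form_lits (Fs' @ ?F # Gs')))"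
    using H(2) distinct_labels_label_form[of N F, unfolded distinct_map] unfolding Hs by auto
  moreover have "is_cirquent (map (image (ins_pos (length Fs))) S, Fs @ F # Gs)"
    using C by (fastforce simp: is_cirquent_def ins_pos_def)
  ultimately show ?thesis
    unfolding binary_tautology_def using H(3)[rule_format] parts
    by (intro conjI exI[of _ "Fs' @ ?F # Gs'"]) (auto simp: len nth map_form_fst_label_form)
qed

text \<open>An ogroup is a disjunction, so enlarging it keeps it valid. This covers at once all
  rules that change only the structure: exchange and weakening of ogroups, and duplication in both
  directions.\<close>

lemma binary_tautology_change_groups:
  assumes "binary_tautology (S, Fs)"
    and "\<And>\<Delta>. \<Delta> \<in> set T \<Longrightarrow> \<Delta> \<subseteq> {..<length Fs} \<and> (\<exists>\<Gamma> \<in> set S. \<Gamma> \<subseteq> \<Delta>)"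
  shows "binary_tautology (T, Fs)"
proof -
  obtain Hs :: "('a \<times> nat) form list" where
    H: "map (map_form fst) Hs = Fs" "distinct (concat (map form_lits Hs))"
    "\<forall>v. \<forall>\<Gamma> \<in> set S. \<exists>i \<in> \<Gamma>. eval_form v (Hs ! i)" "is_cirquent (S, Fs)"
    using assms(1) by (rule binary_tautologyE)
  have "\<exists>i \<in> \<Delta>. eval_form v (Hs ! i)" if "\<Delta> \<in> set T" for v \<Delta>
    using assms(2)[OF that] H(3)[rule_format, of _ v] by blast
  moreover have "is_cirquent (T, Fs)" using assms(2) by (auto simp: is_cirquent_def)
  ultimately show ?thesis
    unfolding binary_tautology_def using H(1,2) by (intro conjI exI[of _ Hs]) auto
qed

section \<open>Soundness of the two connective rules\<close>

lemma conj_ready_skip: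
  assumes "i \<notin> \<Gamma>"
  shows "conj_ready i (\<Gamma> # S) \<longleftrightarrow> Suc i \<notin> \<Gamma> \<and> conj_ready i S"
proof
  assume r: "conj_ready i (\<Gamma> # S)"
  have "Suc i \<notin> \<Gamma>" using r unfolding conj_ready_def by (metis length_Cons nth_Cons_0 zero_less_Suc less_irrefl)
  moreover have "conj_ready i S"
    unfolding conj_ready_def
  proof (intro conjI allI impI)
    fix n assume n: "n < length S"
    note r' = r[unfolded conj_ready_def]
    show "\<not> (i \<in> S ! n \<and> Suc i \<in> S ! n)" using r' n by (metis Suc_less_eq length_Cons nth_Cons_Suc)
    show "Suc n < length S" if "i \<in> S ! n" using r' n that by (metis Suc_less_eq length_Cons nth_Cons_Suc)
    show "Suc i \<in> S ! Suc n" if "i \<in> S ! n" using r' n that by (metis Suc_less_eq length_Cons nth_Cons_Suc)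
    assume "Suc i \<in> S ! n"
    then have "i \<in> (\<Gamma> # S) ! n" using r' n by (metis Suc_less_eq length_Cons nth_Cons_Suc diff_Suc_1)
    \<comment> \<open>For \<open>n = 0\<close> the preceding ogroup would be
      \<open>\<Gamma>\<close>, which does not contain \<open>i\<close>.\<close>
    then show "0 < n" "i \<in> S ! (n - 1)" using assms by (cases n; simp)+
  qed
  ultimately show "Suc i \<notin> \<Gamma> \<and> conj_ready i S" ..
next
  assume "Suc i \<notin> \<Gamma> \<and> conj_ready i S"
  then show "conj_ready i (\<Gamma> # S)"
    using assms unfolding conj_ready_def by (auto simp: All_less_Suc2 nth_Cons')
qed

text \<open>Together with \<open>conj_ready_skip\<close> this turns the positional definition into a
  recursion that runs in step with \<open>unite_pairs\<close>: a head containing \<open>i\<close> is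
  consumed with its successor, and that successor cannot open a pair of its own.\<close>

lemma conj_ready_pair:
  assumes "i \<in> \<Gamma>"
  shows "conj_ready i (\<Gamma> # \<Delta> # S) \<longleftrightarrow>
    Suc i \<notin> \<Gamma> \<and> i \<notin> \<Delta> \<and> Suc i \<in> \<Delta> \<and> conj_ready i S"
proof
  assume r: "conj_ready i (\<Gamma> # \<Delta> # S)"
  note r' = r[unfolded conj_ready_def]
  have 0: "Suc i \<notin> \<Gamma>" "Suc i \<in> \<Delta>" using r' assms by (auto simp: All_less_Suc2)
  then have 1: "i \<notin> \<Delta>" using r' by (auto simp: All_less_Suc2)
  have "conj_ready i S"
    unfolding conj_ready_def
  proof (intro conjI allI impI)
    fix n assume n: "n < length S"
    show "\<not> (i \<in> S ! n \<and> Suc i \<in> S ! n)" using r' n by (auto simp: All_less_Suc2)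
    show "Suc n < length S" if "i \<in> S ! n" using r' n that by (auto simp: All_less_Suc2)
    show "Suc i \<in> S ! Suc n" if "i \<in> S ! n" using r' n that by (auto simp: All_less_Suc2)
    assume "Suc i \<in> S ! n"
    then have "i \<in> (\<Delta> # S) ! n" using r' n by (auto simp: All_less_Suc2)
    then show "0 < n" "i \<in> S ! (n - 1)" using 1 by (cases n; simp)+
  qed
  with 0 1 show "Suc i \<notin> \<Gamma> \<and> i \<notin> \<Delta> \<and> Suc i \<in> \<Delta> \<and> conj_ready i S" by simp
next
  assume "Suc i \<notin> \<Gamma> \<and> i \<notin> \<Delta> \<and> Suc i \<in> \<Delta> \<and> conj_ready i S"
  then show "conj_ready i (\<Gamma> # \<Delta> # S)"
    using assms unfolding conj_ready_def by (auto simp: All_less_Suc2 nth_Cons')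
qed

text \<open>Validity does not depend on the order of the ogroups, so this is all that the
  conjunction rule needs to know about the pairing. Which of the two indices each half lacks is
  essential there.\<close>

lemma unite_pairs_cases:
  assumes "conj_ready i S" "X \<in> set (unite_pairs i S)"
  obtains "X \<in> set S" "i \<notin> X" "Suc i \<notin> X"
  | \<Gamma> \<Delta> where "\<Gamma> \<in> set S" "\<Delta> \<in> set S" "X = \<Gamma> \<union> \<Delta>" "i \<in> \<Gamma>" "Suc i \<notin> \<Gamma>" "i \<notin> \<Delta>" "Suc i \<in> \<Delta>"
proof -
  have "(X \<in> set S \<and> i \<notin> X \<and> Suc i \<notin> X) \<or> (\<exists>\<Gamma> \<in> set S. \<exists>\<Delta> \<in> set S. X = \<Gamma> \<union> \<Delta> \<and>
      i \<in> \<Gamma> \<and> Suc i \<notin> \<Gamma> \<and> i \<notin> \<Delta> \<and> Suc i \<in> \<Delta>)"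
    using assms
  proof (induction i S rule: unite_pairs.induct)
    case (2 i \<Gamma>)
    then show ?case by (auto simp: conj_ready_def)
  next
    case (3 i \<Gamma> \<Delta> S)
    show ?case
    proof (cases "i \<in> \<Gamma>")
      case True
      then have r: "Suc i \<notin> \<Gamma>" "i \<notin> \<Delta>" "Suc i \<in> \<Delta>" "conj_ready i S"
        using "3.prems"(1) conj_ready_pair[OF True, of \<Delta> S] by auto
      have "X = \<Gamma> \<union> \<Delta> \<or> X \<in> set (unite_pairs i S)" using "3.prems"(2) True by simp
      then show ?thesis
      proof
        assume "X = \<Gamma> \<union> \<Delta>"
        then show ?thesis using r True by (intro disjI2 bexI[of _ \<Gamma>] bexI[of _ \<Delta>]) auto
      next
        assume "X \<in> set (unite_pairs i S)"
        from "3.IH"(1)[OF True r(4) this] show ?thesis by (meson list.set_intros(2))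
      qed
    next
      case False
      then have r: "Suc i \<notin> \<Gamma>" "conj_ready i (\<Delta> # S)"
        using "3.prems"(1) conj_ready_skip[OF False, of "\<Delta> # S"] by auto
      have "X = \<Gamma> \<or> X \<in> set (unite_pairs i (\<Delta> # S))" using "3.prems"(2) False by simp
      then show ?thesis
      proof
        assume "X = \<Gamma>"
        then show ?thesis using r False by simp
      next
        assume "X \<in> set (unite_pairs i (\<Delta> # S))"
        from "3.IH"(2)[OF False r(2) this] show ?thesis by (meson list.set_intros(2))
      qed
    qed
  qed auto
  then show thesis using that by blast
qed

lemma nth_merge_pos:
  assumes "j \<noteq> length Fs" "j \<noteq> Suc (length Fs)"
  shows "(Fs @ H # Gs) ! merge_pos (length Fs) j = (Fs @ F # G # Gs) ! j"
  using assms by (auto simp: merge_pos_def nth_append nth_Cons')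

lemma merge_pos_simps [simp]: "merge_pos n n = n" "merge_pos n (Suc n) = n"
  by (auto simp: merge_pos_def)

lemma merge_pos_bound: "j < Suc k \<Longrightarrow> n < k \<Longrightarrow> merge_pos n j < k"
  by (auto simp: merge_pos_def)

lemma binary_tautology_disj_intro:
  assumes "binary_tautology (S, Fs @ F # G # Gs)"
  shows "binary_tautology (map (image (merge_pos (length Fs))) S, Fs @ Disj F G # Gs)"
proof -
  obtain Hs :: "('a \<times> nat) form list" where
    H: "map (map_form fst) Hs = Fs @ F # G # Gs" "distinct (concat (map form_lits Hs))"
    "\<forall>v. \<forall>\<Gamma> \<in> set S. \<exists>i \<in> \<Gamma>. eval_form v (Hs ! i)"
    and C: "is_cirquent (S, Fs @ F # G # Gs)"
    using assms by (rule binary_tautologyE)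
  obtain Fs' F' G' Gs' where Hs: "Hs = Fs' @ F' # G' # Gs'" and
    parts: "map (map_form fst) Fs' = Fs" "map_form fst F' = F" "map_form fst G' = G"
    "map (map_form fst) Gs' = Gs"
    using H(1) by (auto simp: map_eq_append_conv map_eq_Cons_conv)
  have len: "length Fs = length Fs'" using parts(1) by auto
  have nth: "eval_form v ((Fs' @ Disj F' G' # Gs') ! merge_pos (length Fs') i)"
    if "eval_form v (Hs ! i)" for v i
  proof (cases "i = length Fs' \<or> i = Suc (length Fs')")
    case True
    then show ?thesis using that by (auto simp: Hs nth_append)
  next
    case False
    then show ?thesis using that nth_merge_pos[of i Fs' _ Gs' F' G'] by (simp add: Hs)
  qed
  have "distinct (concat (map form_lits (Fs' @ Disj F' G' # Gs')))"
    using H(2) unfolding Hs by simp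
  moreover have "is_cirquent (map (image (merge_pos (length Fs))) S, Fs @ Disj F G # Gs)"
    using C by (fastforce simp: is_cirquent_def intro!: merge_pos_bound)
  moreover have "\<exists>i \<in> \<Gamma>. eval_form v ((Fs' @ Disj F' G' # Gs') ! i)"
    if "\<Gamma> \<in> set (map (image (merge_pos (length Fs))) S)" for v \<Gamma>
    using that H(3)[rule_format, of _ v] nth[of v] unfolding len by fastforce
  ultimately show ?thesis
    unfolding binary_tautology_def using parts
    by (intro conjI exI[of _ "Fs' @ Disj F' G' # Gs'"]) auto
qed

lemma binary_tautology_conj_intro:
  assumes "binary_tautology (S, Fs @ F # G # Gs)" and ready: "conj_ready (length Fs) S"
  shows "binary_tautology
    (map (image (merge_pos (length Fs))) (unite_pairs (length Fs) S), Fs @ Conj F G # Gs)"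
proof -
  obtain Hs :: "('a \<times> nat) form list" where
    H: "map (map_form fst) Hs = Fs @ F # G # Gs" "distinct (concat (map form_lits Hs))"
    "\<forall>v. \<forall>\<Gamma> \<in> set S. \<exists>i \<in> \<Gamma>. eval_form v (Hs ! i)"
    and C: "is_cirquent (S, Fs @ F # G # Gs)"
    using assms(1) by (rule binary_tautologyE)
  obtain Fs' F' G' Gs' where Hs: "Hs = Fs' @ F' # G' # Gs'" and
    parts: "map (map_form fst) Fs' = Fs" "map_form fst F' = F" "map_form fst G' = G"
    "map (map_form fst) Gs' = Gs"
    using H(1) by (auto simp: map_eq_append_conv map_eq_Cons_conv)
  let ?n = "length Fs"
  let ?Hs = "Fs' @ Conj F' G' # Gs'"
  have len: "?n = length Fs'" using parts(1) by auto
  have nth: "?Hs ! merge_pos ?n i = Hs ! i" if "i \<noteq> ?n" "i \<noteq> Suc ?n" for i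
    using that nth_merge_pos[of i Fs' _ Gs' F' G'] by (simp add: Hs len)
  have at: "?Hs ! ?n = Conj F' G'" "Hs ! ?n = F'" "Hs ! Suc ?n = G'"
    by (auto simp: Hs len nth_append)
  have "distinct (concat (map form_lits ?Hs))"
    using H(2) unfolding Hs by simp
  moreover have "X \<subseteq> {..<length (Fs @ F # G # Gs)}" if "X \<in> set (unite_pairs ?n S)" for X
    using unite_pairs_cases[OF ready that] C by cases (auto simp: is_cirquent_def)
  then have "is_cirquent (map (image (merge_pos ?n)) (unite_pairs ?n S), Fs @ Conj F G # Gs)"
    by (fastforce simp: is_cirquent_def intro!: merge_pos_bound)
  moreover have "\<exists>i \<in> merge_pos ?n ` X. eval_form v (?Hs ! i)"
    if "X \<in> set (unite_pairs ?n S)" for v X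
    using ready that
  proof (cases rule: unite_pairs_cases)
    case 1
    then show ?thesis using H(3)[rule_format, OF 1(1), of v] nth by (metis imageI)
  next
    case (2 \<Gamma> \<Delta>)
    show ?thesis
    proof (cases "eval_form v F' \<and> eval_form v G'")
      case True
      then have "eval_form v (?Hs ! merge_pos ?n ?n)" using at by simp
      then show ?thesis using 2 by blast
    next
      case False
      obtain i j where ij: "i \<in> \<Gamma>" "eval_form v (Hs ! i)" "j \<in> \<Delta>" "eval_form v (Hs ! j)"
        using H(3)[rule_format, OF 2(1), of v] H(3)[rule_format, OF 2(2), of v] by blast
      \<comment> \<open>Since \<open>\<Gamma>\<close> lacks \<open>Suc ?n\<close> and
        \<open>\<Delta>\<close> lacks \<open>?n\<close>, two witnesses at the merged positions could
        only be \<open>F'\<close> and \<open>G'\<close> themselves, and these are not both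
        true.\<close>
      have "(i \<noteq> ?n \<and> i \<noteq> Suc ?n) \<or> (j \<noteq> ?n \<and> j \<noteq> Suc ?n)"
        using False ij 2 at by auto
      then have "\<exists>i \<in> \<Gamma> \<union> \<Delta>. i \<noteq> ?n \<and> i \<noteq> Suc ?n \<and> eval_form v (Hs ! i)"
        using ij by blast
      then show ?thesis using nth 2(3) by (metis imageI)
    qed
  qed
  ultimately show ?thesis
    unfolding binary_tautology_def using parts
    by (intro conjI exI[of _ ?Hs]) auto
qed

lemma CL5_binary_tautology: "CL5 C \<Longrightarrow> binary_tautology C"
proof (induction rule: CL5.induct)
  case ax_empty
  then show ?case by (auto simp: binary_tautology_def is_cirquent_def)
next
  case (ax_id F)
  then show ?case by (rule binary_tautology_ax_id)
next
  case (mix S Fs T Gs)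
  then show ?case by (intro binary_tautology_mix)
next
  case (pool_exchange S Fs F G Gs)
  then show ?case by (intro binary_tautology_pool_exchange)
next
  case (group_exchange S \<Gamma> \<Delta> T Fs)
  then have "is_cirquent (S @ \<Gamma> # \<Delta> # T, Fs)" by (auto simp: binary_tautology_def)
  with group_exchange.IH show ?case
    by (elim binary_tautology_change_groups) (auto simp: is_cirquent_def)
next
  case (group_weakening S \<Gamma> T Fs i)
  then have "is_cirquent (S @ \<Gamma> # T, Fs)" by (auto simp: binary_tautology_def)
  with group_weakening(3,2) show ?case
    by (elim binary_tautology_change_groups) (auto simp: is_cirquent_def)
next
  case (pool_weakening S Fs Gs F)
  then show ?case by (intro binary_tautology_pool_weakening)
next
  case (duplication_down S \<Gamma> T Fs)
  then have "is_cirquent (S @ \<Gamma> # T, Fs)" by (auto simp: binary_tautology_def)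
  with duplication_down.IH show ?case
    by (elim binary_tautology_change_groups) (auto simp: is_cirquent_def)
next
  case (duplication_up S \<Gamma> T Fs)
  then have "is_cirquent (S @ \<Gamma> # \<Gamma> # T, Fs)" by (auto simp: binary_tautology_def)
  with duplication_up.IH show ?case
    by (elim binary_tautology_change_groups) (auto simp: is_cirquent_def)
next
  case (disj_intro S Fs F G Gs)
  then show ?case by (intro binary_tautology_disj_intro)
next
  case (conj_intro S Fs F G Gs)
  then show ?case by (intro binary_tautology_conj_intro)
qed

section \<open>From labelled tautologies to arrangements\<close>

text \<open>Negation stands only on atoms, so truth is monotone in the literals. It suffices that
  each literal true under \<open>v\<close> is true in \<open>s\<close>; a consistent situation gives
  this implication but not equality, as it may be false at an input and true at the allocated
  output.\<close>

lemma form_true_map_form: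
  assumes "eval_form v G"
    and "\<And>k. k < length (form_lits G) \<Longrightarrow>
      (case form_lits G ! k of Pos p \<Rightarrow> v p \<longrightarrow> s ! (n + k) | Neg p \<Rightarrow> s ! (n + k) \<longrightarrow> v p)"
  shows "form_true s n (map_form f G)"
  using assms
proof (induction G arbitrary: n)
  case (Lit L)
  from Lit.prems(1) Lit.prems(2)[of 0] show ?case by (cases L) auto
next
  case (Conj F G)
  have "form_true s n (map_form f F)"
  proof (rule Conj.IH(1))
    show "eval_form v F" using Conj.prems by simp
    fix k assume "k < length (form_lits F)"
    then show "case form_lits F ! k of Pos p \<Rightarrow> v p \<longrightarrow> s ! (n + k) | Neg p \<Rightarrow> s ! (n + k) \<longrightarrow> v p"
      using Conj.prems(2)[of k] by (simp add: nth_append)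
  qed
  moreover have "form_true s (n + length (form_lits F)) (map_form f G)"
  proof (rule Conj.IH(2))
    show "eval_form v G" using Conj.prems by simp
    fix k assume "k < length (form_lits G)"
    then show "case form_lits G ! k of Pos p \<Rightarrow> v p \<longrightarrow> s ! (n + length (form_lits F) + k)
      | Neg p \<Rightarrow> s ! (n + length (form_lits F) + k) \<longrightarrow> v p"
      using Conj.prems(2)[of "length (form_lits F) + k"] by (auto simp: nth_append add.assoc split: lit.splits)
  qed
  ultimately show ?case by (simp add: form_lits_map_form)
next
  case (Disj F G)
  have "form_true s n (map_form f F)" if F: "eval_form v F"
    using F
  proof (rule Disj.IH(1))
    fix k assume "k < length (form_lits F)"
    then show "case form_lits F ! k of Pos p \<Rightarrow> v p \<longrightarrow> s ! (n + k) | Neg p \<Rightarrow> s ! (n + k) \<longrightarrow> v p"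
      using Disj.prems(2)[of k] by (simp add: nth_append)
  qed
  moreover have "form_true s (n + length (form_lits F)) (map_form f G)" if G: "eval_form v G"
    using G
  proof (rule Disj.IH(2))
    fix k assume "k < length (form_lits G)"
    then show "case form_lits G ! k of Pos p \<Rightarrow> v p \<longrightarrow> s ! (n + length (form_lits F) + k)
      | Neg p \<Rightarrow> s ! (n + length (form_lits F) + k) \<longrightarrow> v p"
      using Disj.prems(2)[of "length (form_lits F) + k"] by (auto simp: nth_append add.assoc split: lit.splits)
  qed
  ultimately show ?case using Disj.prems(1) by (auto simp: form_lits_map_form)
qed

lemma binary_tautology_trivial:
  assumes "binary_tautology C"
  shows "trivial_cirquent C"
proof -
  obtain S Fs where C: "C = (S, Fs)" by (cases C)
  obtain Gs :: "('a \<times> nat) form list" where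
    Gs: "map (map_form fst) Gs = Fs" "distinct (concat (map form_lits Gs))"
    and taut: "\<forall>v. \<forall>\<Gamma> \<in> set S. \<exists>i \<in> \<Gamma>. eval_form v (Gs ! i)"
    and wf: "is_cirquent (S, Fs)"
    using assms unfolding C by (rule binary_tautologyE)
  define L where "L = concat (map form_lits Gs)"
  have lits_map: "concat (map form_lits (map (map_form fst) Hs)) =
      map (map_lit fst) (concat (map form_lits Hs))" for Hs :: "('a \<times> nat) form list"
    by (induction Hs) (auto simp: form_lits_map_form)
  have lits: "cirquent_lits C = map (map_lit fst) L"
    unfolding cirquent_lits_def C L_def using lits_map[of Gs] Gs(1) by simp
  have dist: "distinct L" using Gs(2) by (simp add: L_def)
  define A where "A = {(x, y). x < length L \<and> y < length L \<and> (\<exists>p. L ! x = Neg p \<and> L ! y = Pos p)}"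
  have "is_arrangement (club C) A"
    unfolding is_arrangement_def is_allocation_def club_def lits A_def by auto
  moreover have "monogamous A"
    unfolding monogamous_def A_def using dist by (auto simp: nth_eq_iff_index_eq[OF dist, symmetric])
  moreover have "trivializing (club C) A"
    unfolding trivializing_def
  proof (intro allI impI)
    fix s assume cons: "consistent s A"
    \<comment> \<open>The valuation reads each label off its output port, and off its input port
      only if there is no output. At a matched input, consistency yields the required implication
      from \<open>s\<close> to \<open>v\<close>. Labels that do not occur get
      \<open>False\<close>.\<close>
    define v where "v p \<longleftrightarrow> (\<exists>y < length L. L ! y = Pos p \<and> s ! y) \<or>
      ((\<forall>y < length L. L ! y \<noteq> Pos p) \<and> (\<exists>x < length L. L ! x = Neg p \<and> s ! x))" for p
    have v: "case L ! k of Pos p \<Rightarrow> v p \<longrightarrow> s ! k | Neg p \<Rightarrow> s ! k \<longrightarrow> v p" if k: "k < length L" for k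
    proof (cases "L ! k")
      case (Pos p)
      then have "s ! k" if "v p"
        using that k dist unfolding v_def by (metis nth_eq_iff_index_eq)
      then show ?thesis using Pos by simp
    next
      case (Neg p)
      have "v p" if "s ! k"
      proof (cases "\<exists>y < length L. L ! y = Pos p")
        case True
        then obtain y where y: "y < length L" "L ! y = Pos p" by blast
        then have "(k, y) \<in> A" using k Neg by (auto simp: A_def)
        then have "s ! y" using cons that unfolding consistent_def by auto
        then show ?thesis using y unfolding v_def by blast
      next
        case False
        then show ?thesis using k Neg that unfolding v_def by blast
      qed
      then show ?thesis using Neg by simp
    qed
    have "group_true s Fs \<Gamma>" if \<Gamma>: "\<Gamma> \<in> set S" for \<Gamma>
    proof -
      obtain i where i: "i \<in> \<Gamma>" "eval_form v (Gs ! i)" using taut[rule_format, OF \<Gamma>] by blast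
      have len: "length Fs = length Gs" using Gs(1) by auto
      have ib: "i < length Gs" using wf \<Gamma> i(1) len by (auto simp: is_cirquent_def)
      let ?n = "length (concat (map form_lits (take i Gs)))"
      have n: "length (concat (map form_lits (take i Fs))) = ?n"
        using lits_map[of "take i Gs"] unfolding Gs(1)[symmetric] take_map by simp
      have L: "L = concat (map form_lits (take i Gs)) @ form_lits (Gs ! i) @
          concat (map form_lits (drop (Suc i) Gs))"
        unfolding L_def by (subst id_take_nth_drop[OF ib]) simp
      have "form_true s ?n (map_form fst (Gs ! i))"
        using i(2)
      proof (rule form_true_map_form)
        fix k assume k: "k < length (form_lits (Gs ! i))"
        have "L ! (?n + k) = form_lits (Gs ! i) ! k"
          unfolding L using k by (simp add: nth_append del: length_concat)
        moreover have "?n + k < length L"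
          unfolding L using k by (simp del: length_concat)
        ultimately show "case form_lits (Gs ! i) ! k of Pos p \<Rightarrow> v p \<longrightarrow> s ! (?n + k)
            | Neg p \<Rightarrow> s ! (?n + k) \<longrightarrow> v p"
          using v by metis
      qed
      moreover have "Fs ! i = map_form fst (Gs ! i)" using Gs(1) ib by auto
      ultimately show ?thesis
        unfolding group_true_def oform_true_def using i(1) n by metis
    qed
    then show "snd (club C) s" by (simp add: club_def cirquent_true_def C)
  qed
  ultimately show ?thesis
    unfolding trivial_cirquent_def trivial_resource_def by blast
qed


section \<open>Completeness\<close>

text \<open>The interface depends only on the sequence of literals, which decomposing a connective
  leaves alone. Hence one and the same arrangement serves before and after the step.\<close>

lemma trivial_cirquent_mono:
  assumes "trivial_cirquent C" "cirquent_lits D = cirquent_lits C"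
    and "\<And>s. cirquent_true s C \<Longrightarrow> cirquent_true s D"
  shows "trivial_cirquent D"
proof -
  obtain A where "is_arrangement (club C) A" "monogamous A" "trivializing (club C) A"
    using assms(1) unfolding trivial_cirquent_def trivial_resource_def by blast
  moreover have fst: "fst (club D) = fst (club C)" using assms(2) by (simp add: club_def)
  ultimately have "is_arrangement (club D) A \<and> monogamous A \<and> trivializing (club D) A"
    using assms(3) fst by (simp add: is_arrangement_def is_allocation_def trivializing_def)
      (simp add: club_def)
  then show ?thesis unfolding trivial_cirquent_def trivial_resource_def by blast
qed

text \<open>The merged formula has as many literals as its two parts together, so every other
  oformula keeps its offset in the situation. Leaving \<open>H\<close> arbitrary lets both
  connectives use this.\<close>

lemma oform_true_merge_pos:
  assumes "j \<noteq> length Fs" "j \<noteq> Suc (length Fs)"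
    and "length (form_lits H) = length (form_lits F) + length (form_lits G)"
  shows "oform_true s (Fs @ H # Gs) (merge_pos (length Fs) j) = oform_true s (Fs @ F # G # Gs) j"
proof -
  let ?l = "\<lambda>Hs. length (concat (map form_lits Hs))"
  have "?l (take (merge_pos (length Fs) j) (Fs @ H # Gs)) = ?l (take j (Fs @ F # G # Gs))"
  proof (cases "j < length Fs")
    case True
    then show ?thesis by (simp add: merge_pos_def)
  next
    case False
    then obtain k where "j = Suc (Suc (length Fs + k))"
      using assms(1,2) that[of "j - Suc (Suc (length Fs))"] by auto
    then show ?thesis using assms(3) by (simp add: merge_pos_def Suc_diff_le)
  qed
  then show ?thesis
    unfolding oform_true_def nth_merge_pos[OF assms(1,2), of H Gs F G] by simp
qed

lemma oform_true_at:
  "oform_true s (Fs @ F # Gs) (length Fs) = form_true s (length (concat (map form_lits Fs))) F"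
  "oform_true s (Fs @ F # G # Gs) (Suc (length Fs)) =
    form_true s (length (concat (map form_lits Fs)) + length (form_lits F)) G"
  by (auto simp: oform_true_def nth_append)

text \<open>A bottom-up step forms preimages of ogroups whereas the rules form images; by
  surjectivity the rule restores exactly the original ogroup.\<close>

lemma merge_pos_surj: "merge_pos n ` (merge_pos n -` \<Gamma>) = \<Gamma>"
proof -
  have "j \<in> range (merge_pos n)" for j
    by (cases "j \<le> n") (auto simp: merge_pos_def image_iff intro: exI[of _ j] exI[of _ "Suc j"])
  then show ?thesis by (auto simp: image_vimage_eq)
qed

lemma merge_pos_vimage_bound:
  "\<Gamma> \<subseteq> {..<k} \<Longrightarrow> n < k \<Longrightarrow> merge_pos n -` \<Gamma> \<subseteq> {..<Suc k}"
  by (auto simp: merge_pos_def split: if_splits)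

lemma group_true_disj:
  "group_true s (Fs @ Disj F G # Gs) \<Gamma> \<longleftrightarrow>
    group_true s (Fs @ F # G # Gs) (merge_pos (length Fs) -` \<Gamma>)" (is "?l \<longleftrightarrow> ?r")
proof -
  let ?n = "length Fs"
  have *: "oform_true s (Fs @ Disj F G # Gs) (merge_pos ?n j) = oform_true s (Fs @ F # G # Gs) j"
    if "j \<noteq> ?n" "j \<noteq> Suc ?n" for j
    using that by (rule oform_true_merge_pos) simp
  have 0: "oform_true s (Fs @ Disj F G # Gs) ?n \<longleftrightarrow>
      oform_true s (Fs @ F # G # Gs) ?n \<or> oform_true s (Fs @ F # G # Gs) (Suc ?n)"
    by (simp add: oform_true_at)
  have "?l \<longleftrightarrow> (\<exists>j \<in> merge_pos ?n -` \<Gamma>. oform_true s (Fs @ Disj F G # Gs) (merge_pos ?n j))"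
    unfolding group_true_def by (subst (1) merge_pos_surj[of ?n \<Gamma>, symmetric]) blast
  also have "\<dots> \<longleftrightarrow> ?r"
    unfolding group_true_def vimage_def using * 0 by (metis mem_Collect_eq merge_pos_simps)
  finally show ?thesis .
qed

text \<open>The two halves differ only in the conjunct they keep and share all other oformulas. The
  half with the left conjunct comes first, as \<open>conj_ready\<close> demands.\<close>

definition split_group :: "nat \<Rightarrow> nat set \<Rightarrow> nat set list" where
  "split_group n \<Gamma> = (if n \<in> \<Gamma> then [merge_pos n -` \<Gamma> - {Suc n}, merge_pos n -` \<Gamma> - {n}]
     else [merge_pos n -` \<Gamma>])"

lemma conj_ready_split: "conj_ready n (concat (map (split_group n) S))"
proof (induction S)
  case Nil
  then show ?case by (simp add: conj_ready_def)
next
  case (Cons \<Gamma> S)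
  then show ?case by (auto simp: split_group_def conj_ready_pair conj_ready_skip)
qed

lemma unite_pairs_skip: "n \<notin> \<Gamma> \<Longrightarrow> unite_pairs n (\<Gamma> # S) = \<Gamma> # unite_pairs n S"
  by (cases S) auto

lemma unite_pairs_split: "unite_pairs n (concat (map (split_group n) S)) = map (vimage (merge_pos n)) S"
proof (induction S)
  case (Cons \<Gamma> S)
  then show ?case by (auto simp: split_group_def unite_pairs_skip)
qed simp

text \<open>This is distributivity of disjunction over conjunction, at the level of occurrences:
  both halves point to the same remaining oformulas.\<close>

lemma group_true_conj:
  "group_true s (Fs @ Conj F G # Gs) \<Gamma> \<longleftrightarrow>
    (\<forall>\<Delta> \<in> set (split_group (length Fs) \<Gamma>). group_true s (Fs @ F # G # Gs) \<Delta>)" (is "?l \<longleftrightarrow> ?r")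
proof -
  let ?n = "length Fs"
  have *: "oform_true s (Fs @ Conj F G # Gs) (merge_pos ?n j) = oform_true s (Fs @ F # G # Gs) j"
    if "j \<noteq> ?n" "j \<noteq> Suc ?n" for j
    using that by (rule oform_true_merge_pos) simp
  have 0: "oform_true s (Fs @ Conj F G # Gs) ?n \<longleftrightarrow>
      oform_true s (Fs @ F # G # Gs) ?n \<and> oform_true s (Fs @ F # G # Gs) (Suc ?n)"
    by (simp add: oform_true_at)
  have l: "?l \<longleftrightarrow> (\<exists>j. merge_pos ?n j \<in> \<Gamma> \<and> oform_true s (Fs @ Conj F G # Gs) (merge_pos ?n j))"
    unfolding group_true_def by (subst (1) merge_pos_surj[of ?n \<Gamma>, symmetric]) blast
  show ?thesis
  proof (cases "?n \<in> \<Gamma>")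
    case True
    have "?r \<longleftrightarrow> (\<exists>j. merge_pos ?n j \<in> \<Gamma> \<and> j \<noteq> Suc ?n \<and> oform_true s (Fs @ F # G # Gs) j) \<and>
        (\<exists>j. merge_pos ?n j \<in> \<Gamma> \<and> j \<noteq> ?n \<and> oform_true s (Fs @ F # G # Gs) j)"
      using True by (auto simp: split_group_def group_true_def)
    moreover have "?l \<longleftrightarrow> \<dots>"
    proof
      assume ?l
      then obtain j where j: "merge_pos ?n j \<in> \<Gamma>" "oform_true s (Fs @ Conj F G # Gs) (merge_pos ?n j)"
        unfolding l by blast
      show "(\<exists>j. merge_pos ?n j \<in> \<Gamma> \<and> j \<noteq> Suc ?n \<and> oform_true s (Fs @ F # G # Gs) j) \<and>
        (\<exists>j. merge_pos ?n j \<in> \<Gamma> \<and> j \<noteq> ?n \<and> oform_true s (Fs @ F # G # Gs) j)"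
      proof (cases "j = ?n \<or> j = Suc ?n")
        case True
        then show ?thesis using j 0 by (intro conjI exI[of _ ?n] exI[of _ "Suc ?n"]) auto
      next
        case False
        then show ?thesis using j *[of j] by (intro conjI exI[of _ j]) auto
      qed
    next
      assume "(\<exists>j. merge_pos ?n j \<in> \<Gamma> \<and> j \<noteq> Suc ?n \<and> oform_true s (Fs @ F # G # Gs) j) \<and>
        (\<exists>j. merge_pos ?n j \<in> \<Gamma> \<and> j \<noteq> ?n \<and> oform_true s (Fs @ F # G # Gs) j)"
      then obtain j k where jk: "merge_pos ?n j \<in> \<Gamma>" "j \<noteq> Suc ?n" "oform_true s (Fs @ F # G # Gs) j"
        "merge_pos ?n k \<in> \<Gamma>" "k \<noteq> ?n" "oform_true s (Fs @ F # G # Gs) k"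
        by blast
      \<comment> \<open>A witness outside the merged pair already makes the original ogroup true;
        otherwise the two witnesses are the conjuncts.\<close>
      then consider "j \<noteq> ?n" | "k \<noteq> Suc ?n" | "j = ?n" "k = Suc ?n" by blast
      then show ?l
      proof cases
        case 1
        then show ?thesis unfolding l using jk *[of j] by blast
      next
        case 2
        then show ?thesis unfolding l using jk *[of k] by blast
      next
        case 3
        then show ?thesis unfolding l using jk 0 by (intro exI[of _ ?n]) auto
      qed
    qed
    ultimately show ?thesis by blast
  next
    case False
    have "?r \<longleftrightarrow> (\<exists>j. merge_pos ?n j \<in> \<Gamma> \<and> oform_true s (Fs @ F # G # Gs) j)"
      using False by (auto simp: split_group_def group_true_def)
    then show ?thesis unfolding l using * False by (metis merge_pos_simps)
  qed
qed

section \<open>Provability and the order, multiplicity and size of ogroups\<close>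

text \<open>Exchange bubbles the next wanted ogroup to the front; \<open>U\<close> collects the part
  already in place.\<close>

lemma CL5_permute_groups:
  "mset S = mset T \<Longrightarrow> CL5 (U @ S, Fs) \<Longrightarrow> CL5 (U @ T, Fs)"
proof (induction T arbitrary: S U)
  case (Cons \<Gamma> T)
  have move: "CL5 (U @ xs @ \<Gamma> # ys, Fs) \<Longrightarrow> CL5 (U @ \<Gamma> # xs @ ys, Fs)" for xs ys
  proof (induction xs arbitrary: ys rule: rev_induct)
    case (snoc x xs)
    have "CL5 ((U @ xs) @ \<Gamma> # x # ys, Fs)"
      using snoc.prems group_exchange[of "U @ xs" x \<Gamma> ys Fs] by simp
    then show ?case using snoc.IH[of "x # ys"] by simp
  qed simp
  have "\<Gamma> \<in> set S" using Cons.prems(1) by (metis list.set_intros(1) set_mset_mset)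
  then obtain xs ys where S: "S = xs @ \<Gamma> # ys" by (meson split_list)
  have "CL5 ((U @ [\<Gamma>]) @ xs @ ys, Fs)" using move Cons.prems(2) S by simp
  moreover have "mset (xs @ ys) = mset T" using Cons.prems(1) S by simp
  ultimately show ?case using Cons.IH[of "xs @ ys" "U @ [\<Gamma>]"] by simp
qed simp

lemma CL5_remdups_groups: "CL5 (U @ S, Fs) \<longleftrightarrow> CL5 (U @ remdups S, Fs)"
proof (induction S arbitrary: U)
  case (Cons \<Gamma> S)
  show ?case
  proof (cases "\<Gamma> \<in> set S")
    case True
    then obtain xs ys where S: "S = xs @ \<Gamma> # ys" by (meson split_list)
    have "CL5 (U @ \<Gamma> # S, Fs) \<longleftrightarrow> CL5 (U @ \<Gamma> # \<Gamma> # xs @ ys, Fs)"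
      using CL5_permute_groups[of "\<Gamma> # S" "\<Gamma> # \<Gamma> # xs @ ys" U]
        CL5_permute_groups[of "\<Gamma> # \<Gamma> # xs @ ys" "\<Gamma> # S" U] by (auto simp: S)
    also have "\<dots> \<longleftrightarrow> CL5 (U @ \<Gamma> # xs @ ys, Fs)"
      using duplication_down duplication_up by blast
    also have "\<dots> \<longleftrightarrow> CL5 (U @ S, Fs)"
      using CL5_permute_groups[of S "\<Gamma> # xs @ ys" U]
        CL5_permute_groups[of "\<Gamma> # xs @ ys" S U] by (auto simp: S)
    finally show ?thesis using Cons.IH[of U] True by simp
  next
    case False
    then show ?thesis using Cons.IH[of "U @ [\<Gamma>]"] by simp
  qed
qed simp

text \<open>A structure thus matters only as a set. This lets one allocation, introduced by a single
  axiom, serve several ogroups.\<close>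

lemma CL5_set_groups:
  assumes "CL5 (S, Fs)" "set S = set T"
  shows "CL5 (T, Fs)"
proof -
  have "CL5 (remdups S, Fs)" using assms(1) CL5_remdups_groups[of "[]"] by auto
  moreover have "mset (remdups S) = mset (remdups T)"
    using assms(2) by (simp add: set_eq_iff_mset_remdups_eq)
  ultimately have "CL5 (remdups T, Fs)"
    using CL5_permute_groups[of "remdups S" "remdups T" "[]" Fs] by simp
  then show ?thesis using CL5_remdups_groups[of "[]"] by auto
qed

lemma CL5_weaken_group:
  assumes "CL5 (U @ \<Gamma> # T, Fs)" "finite \<Delta>" "\<Delta> \<subseteq> {..<length Fs}"
  shows "CL5 (U @ (\<Delta> \<union> \<Gamma>) # T, Fs)"
  using assms(2,3)
proof (induction \<Delta> rule: finite_induct)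
  case (insert x \<Delta>)
  then show ?case using group_weakening[of U "\<Delta> \<union> \<Gamma>" T Fs x] by auto
qed (use assms(1) in simp)

lemma CL5_weaken_groups:
  assumes "list_all2 (\<subseteq>) S T" "CL5 (U @ S, Fs)" "\<forall>\<Delta> \<in> set T. \<Delta> \<subseteq> {..<length Fs}"
  shows "CL5 (U @ T, Fs)"
  using assms
proof (induction S T arbitrary: U rule: list_all2_induct)
  case (Cons \<Gamma> S \<Delta> T)
  have "CL5 (U @ (\<Delta> \<union> \<Gamma>) # S, Fs)"
    using Cons.prems by (intro CL5_weaken_group) (auto intro: finite_subset)
  then have "CL5 ((U @ [\<Delta>]) @ S, Fs)" using Cons.hyps(1) by (simp add: Un_absorb2)
  then show ?case using Cons.IH[of "U @ [\<Delta>]"] Cons.prems by simp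
qed simp

section \<open>Pools with labelled positions\<close>

text \<open>Pool positions are tracked by a list of distinct labels \<open>ls\<close>: in this notation ogroups are
  sets of labels, which the pool rules leave unchanged.\<close>

definition places :: "nat list \<Rightarrow> nat set \<Rightarrow> nat set" where
  "places ls \<Gamma> = {i. i < length ls \<and> ls ! i \<in> \<Gamma>}"

definition labelled_CL5 :: "(nat \<Rightarrow> 'a form) \<Rightarrow> nat set list \<Rightarrow> nat list \<Rightarrow> bool" where
  "labelled_CL5 \<phi> S ls \<longleftrightarrow> CL5 (map (places ls) S, map \<phi> ls)"

lemma places_Cons: "places (l # ls) \<Gamma> = (if l \<in> \<Gamma> then {0} else {}) \<union> Suc ` places ls \<Gamma>"
proof (rule set_eqI)
  fix i
  show "i \<in> places (l # ls) \<Gamma> \<longleftrightarrow> i \<in> (if l \<in> \<Gamma> then {0} else {}) \<union> Suc ` places ls \<Gamma>"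
    by (cases i) (auto simp: places_def)
qed

lemma places_upt: "\<Gamma> \<subseteq> {..<n} \<Longrightarrow> places [0..<n] \<Gamma> = \<Gamma>"
  by (auto simp: places_def subset_iff)

lemma places_swap:
  "places (xs @ b # a # ys) \<Gamma> =
    transpose (length xs) (Suc (length xs)) ` places (xs @ a # b # ys) \<Gamma>"
proof -
  let ?t = "transpose (length xs) (Suc (length xs))"
  \<comment> \<open>A transposition is its own inverse, so images under it are preimages.\<close>
  have "i \<in> ?t ` X \<longleftrightarrow> ?t i \<in> X" for i X
    by (auto intro: image_eqI[of _ _ "?t i"])
  moreover have mem: "i \<in> places (xs @ b # a # ys) \<Gamma> \<longleftrightarrow> ?t i \<in> places (xs @ a # b # ys) \<Gamma>" for i
  proof -
    consider "i < length xs" | "i = length xs" | "i = Suc (length xs)" | k where "i = Suc (Suc (length xs + k))"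
      by (metis add_Suc_right less_imp_Suc_add linorder_neqE_nat not_less_eq)
    then show ?thesis by cases (auto simp: places_def transpose_def nth_append)
  qed
  ultimately show ?thesis
    by (intro set_eqI) (simp add: mem)
qed

lemma labelled_swap:
  assumes "labelled_CL5 \<phi> S (xs @ a # b # ys)"
  shows "labelled_CL5 \<phi> S (xs @ b # a # ys)"
proof -
  have "CL5 (map (places (xs @ a # b # ys)) S, map \<phi> xs @ \<phi> a # \<phi> b # map \<phi> ys)"
    using assms by (simp add: labelled_CL5_def)
  from pool_exchange[OF this] show ?thesis
    unfolding labelled_CL5_def places_swap[of xs b a ys, abs_def] by (simp add: comp_def)
qed

lemma labelled_permute:
  "mset ls = mset ks \<Longrightarrow> labelled_CL5 \<phi> S (us @ ls) \<Longrightarrow> labelled_CL5 \<phi> S (us @ ks)"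
proof (induction ks arbitrary: ls us)
  case (Cons k ks)
  have move: "labelled_CL5 \<phi> S (us @ xs @ k # ys) \<Longrightarrow> labelled_CL5 \<phi> S (us @ k # xs @ ys)" for xs ys
  proof (induction xs arbitrary: ys rule: rev_induct)
    case (snoc x xs)
    have "labelled_CL5 \<phi> S ((us @ xs) @ k # x # ys)"
      using snoc.prems labelled_swap[of \<phi> S "us @ xs" x k ys] by simp
    then show ?case using snoc.IH[of "x # ys"] by simp
  qed simp
  have "k \<in> set ls" using Cons.prems(1) by (metis list.set_intros(1) set_mset_mset)
  then obtain xs ys where ls: "ls = xs @ k # ys" by (meson split_list)
  have "labelled_CL5 \<phi> S ((us @ [k]) @ xs @ ys)" using move Cons.prems(2) ls by simp
  moreover have "mset (xs @ ys) = mset ks" using Cons.prems(1) ls by simp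
  ultimately show ?case using Cons.IH[of "xs @ ys" "us @ [k]"] by simp
qed simp

lemma labelled_weaken_pool:
  assumes "labelled_CL5 \<phi> S ls" "set ks \<inter> \<Union> (set S) = {}"
  shows "labelled_CL5 \<phi> S (ks @ ls)"
  using assms(2)
proof (induction ks)
  case (Cons k ks)
  have "CL5 (map (places (ks @ ls)) S, [] @ map \<phi> (ks @ ls))"
    using Cons by (simp add: labelled_CL5_def)
  from pool_weakening[OF this, of "\<phi> k"]
  have "CL5 (map (image Suc \<circ> places (ks @ ls)) S, map \<phi> (k # ks @ ls))"
    by (simp add: ins_pos_def[abs_def])
  moreover have "map (image Suc \<circ> places (ks @ ls)) S = map (places (k # ks @ ls)) S"
    using Cons.prems by (auto simp: places_Cons)
  ultimately show ?case by (simp add: labelled_CL5_def)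
qed (use assms(1) in simp)

text \<open>Mix places the axiom in front and shifts everything else by 2. Freshness for
  \<open>ls\<close> makes the new ogroup exactly the first two positions; freshness for
  \<open>S\<close> keeps these positions out of the old ogroups.\<close>

lemma labelled_add_pair:
  assumes "labelled_CL5 \<phi> S ls" "x \<noteq> y" "x \<notin> set ls" "y \<notin> set ls"
    and "x \<notin> \<Union> (set S)" "y \<notin> \<Union> (set S)"
    and "\<phi> x = Lit (Neg p)" "\<phi> y = Lit (Pos p)"
  shows "labelled_CL5 \<phi> ({x, y} # S) (x # y # ls)"
proof -
  have "CL5 (map (places ls) S, map \<phi> ls)" using assms(1) by (simp add: labelled_CL5_def)
  from mix[OF ax_id[of "Lit (Pos p)"] this]
  have "CL5 ({0, 1} # map (image (\<lambda>j. j + 2) \<circ> places ls) S, map \<phi> (x # y # ls))"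
    using assms(7,8) by (simp add: numeral_2_eq_2)
  moreover have "places ls {x, y} = {}"
    using assms(3,4) by (auto simp: places_def)
  then have "places (x # y # ls) {x, y} = {0, 1}" by (auto simp: places_Cons)
  moreover have "map (image (\<lambda>j. j + 2) \<circ> places ls) S = map (places (x # y # ls)) S"
    using assms(5,6) by (auto simp: places_Cons image_image)
  ultimately show ?thesis by (simp only: labelled_CL5_def list.map)
qed

text \<open>Monogamy enters here: allocations without common ports give pairs with disjoint labels,
  which is just what mix can put side by side.\<close>

lemma labelled_allocations:
  assumes "finite A" "monogamous A"
    and "\<forall>(x, y) \<in> A. \<exists>p. \<phi> x = Lit (Neg p) \<and> \<phi> y = Lit (Pos p)"
  shows "\<exists>S ls. set S = (\<lambda>(x, y). {x, y}) ` A \<and> distinct ls \<and> set ls = fst ` A \<union> snd ` A \<and>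
    labelled_CL5 \<phi> S ls"
  using assms
proof (induction A rule: finite_induct)
  case empty
  show ?case by (intro exI[of _ "[]"]) (simp add: labelled_CL5_def ax_empty)
next
  case (insert a A)
  obtain x y where a: "a = (x, y)" by (cases a)
  have "monogamous A" using insert.prems(1) unfolding monogamous_def by blast
  then obtain S ls where S: "set S = (\<lambda>(x, y). {x, y}) ` A" "distinct ls"
    "set ls = fst ` A \<union> snd ` A" "labelled_CL5 \<phi> S ls"
    using insert.IH insert.prems(2) by auto
  obtain p where p: "\<phi> x = Lit (Neg p)" "\<phi> y = Lit (Pos p)" using insert.prems(2) a by auto
  then have xy: "x \<noteq> y" by auto
  have fresh: "x \<notin> {fst b, snd b}" "y \<notin> {fst b, snd b}" if "b \<in> A" for b
  proof -
    have "a \<noteq> b" using that insert.hyps(2) by auto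
    then show "x \<notin> {fst b, snd b}" "y \<notin> {fst b, snd b}"
      using insert.prems(1) that a unfolding monogamous_def by (metis fst_conv snd_conv insertCI)+
  qed
  then have l: "x \<notin> set ls" "y \<notin> set ls" unfolding S(3) by auto
  have g: "x \<notin> \<Union> (set S)" "y \<notin> \<Union> (set S)" unfolding S(1) by (auto dest: fresh)
  have "labelled_CL5 \<phi> ({x, y} # S) (x # y # ls)"
    using S(4) xy l g p by (rule labelled_add_pair)
  then show ?case
    using S xy l a by (intro exI[of _ "{x, y} # S"] exI[of _ "x # y # ls"]) auto
qed

lemma CL5_allocations:
  assumes "monogamous A" "A \<subseteq> {..<length Ls} \<times> {..<length Ls}"
    and "\<forall>(x, y) \<in> A. \<exists>p. Ls ! x = Neg p \<and> Ls ! y = Pos p"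
  obtains S where "set S = (\<lambda>(x, y). {x, y}) ` A" "CL5 (S, map Lit Ls)"
proof -
  let ?\<phi> = "\<lambda>i. Lit (Ls ! i)"
  have "finite A" using assms(2) finite_subset by blast
  then obtain S ls where S: "set S = (\<lambda>(x, y). {x, y}) ` A" "distinct ls"
    "set ls = fst ` A \<union> snd ` A" "labelled_CL5 ?\<phi> S ls"
    using labelled_allocations[of A ?\<phi>] assms(1,3) by auto
  have sub: "set ls \<subseteq> {..<length Ls}" "\<Union> (set S) \<subseteq> set ls"
    using assms(2) unfolding S(1,3) by force+
  \<comment> \<open>Positions outside all allocations enter by pool weakening; sorting the labels
    afterwards restores the given pool.\<close>
  define ks where "ks = filter (\<lambda>i. i \<notin> set ls) [0..<length Ls]"
  have "labelled_CL5 ?\<phi> S (ks @ ls)"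
    using S(4) sub(2) by (intro labelled_weaken_pool) (auto simp: ks_def)
  moreover have "mset (ks @ ls) = mset [0..<length Ls]"
    using S(2) sub(1) by (subst set_eq_iff_mset_eq_distinct[symmetric]) (auto simp: ks_def)
  ultimately have "labelled_CL5 ?\<phi> S [0..<length Ls]"
    using labelled_permute[of "ks @ ls" "[0..<length Ls]" ?\<phi> S "[]"] by simp
  moreover have "map (places [0..<length Ls]) S = S"
    using sub by (intro map_idI places_upt) blast
  moreover have "map ?\<phi> [0..<length Ls] = map Lit Ls"
    by (rule nth_equalityI) auto
  ultimately have "CL5 (S, map Lit Ls)" by (simp add: labelled_CL5_def)
  with S(1) show thesis by (rule that)
qed

section \<open>Cirquents of literals\<close>

text \<open>If an ogroup of literals contained no allocation, its literals could all be falsified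
  consistently with the arrangement.\<close>

lemma group_contains_allocation:
  assumes triv: "\<And>s. length s = length Ls \<Longrightarrow> consistent s A \<Longrightarrow> group_true s (map Lit Ls) \<Gamma>"
    and A: "\<forall>(x, y) \<in> A. x < length Ls \<and> y < length Ls \<and> (\<exists>p. Ls ! x = Neg p \<and> Ls ! y = Pos p)"
    and \<Gamma>: "\<Gamma> \<subseteq> {..<length Ls}"
  shows "\<exists>(x, y) \<in> A. {x, y} \<subseteq> \<Gamma>"
proof (rule ccontr)
  assume none: "\<not> ?thesis"
  \<comment> \<open>Inside \<open>\<Gamma>\<close> every literal is made false, outside every
    literal is made true. An allocation is then violated only by a true input, which lies in
    \<open>\<Gamma>\<close>, and a false output, which also lies in \<open>\<Gamma>\<close>.\<close>
  define s where "s = map (\<lambda>i. (i \<in> \<Gamma>) = (\<exists>p. Ls ! i = Neg p)) [0..<length Ls]"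
  have "consistent s A"
    unfolding consistent_def
  proof (clarify, rule le_boolI)
    fix x y assume xy: "(x, y) \<in> A" and "s ! x"
    then have "x \<in> \<Gamma>" using A unfolding s_def by fastforce
    then have "y \<notin> \<Gamma>" using none xy by auto
    then show "s ! y" using A xy unfolding s_def by fastforce
  qed
  then obtain i where i: "i \<in> \<Gamma>" "oform_true s (map Lit Ls) i"
    using triv[of s] by (auto simp: s_def group_true_def)
  then have ib: "i < length Ls" using \<Gamma> by auto
  have "length (concat (map form_lits (take i (map Lit Ls)))) = i"
    using ib by (simp add: length_concat take_map comp_def sum_list_triv)
  then have "form_true s i (Lit (Ls ! i))" using i(2) ib by (simp add: oform_true_def)
  then show False using i(1) ib by (cases "Ls ! i") (auto simp: s_def)
qed

text \<open>One allocation is chosen inside each ogroup. The chosen pairs form a provable structure,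
  and each pair is then weakened to its ogroup.\<close>

lemma CL5_literals:
  assumes wf: "is_cirquent (S, map Lit Ls)" and triv: "trivial_cirquent (S, map Lit Ls)"
  shows "CL5 (S, map Lit Ls)"
proof -
  have lits: "cirquent_lits (S, map Lit Ls) = Ls"
    by (simp add: cirquent_lits_def comp_def)
  have port: "lit_port L = Input p \<longleftrightarrow> L = Neg p" "lit_port L = Output p \<longleftrightarrow> L = Pos p" for L :: "'a lit" and p
    by (cases L; auto)+
  obtain A where A: "monogamous A"
    "\<forall>(x, y) \<in> A. x < length Ls \<and> y < length Ls \<and> (\<exists>p. Ls ! x = Neg p \<and> Ls ! y = Pos p)"
    "\<And>s. length s = length Ls \<Longrightarrow> consistent s A \<Longrightarrow> cirquent_true s (S, map Lit Ls)"
    using triv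
    unfolding trivial_cirquent_def trivial_resource_def is_arrangement_def is_allocation_def
      trivializing_def is_situation_def club_def lits
    by (fastforce simp: port)
  have "\<exists>a. a \<in> A \<and> {fst a, snd a} \<subseteq> \<Gamma>" if "\<Gamma> \<in> set S" for \<Gamma>
    using group_contains_allocation[of Ls A \<Gamma>] A that wf
    by (fastforce simp: cirquent_true_def is_cirquent_def)
  then obtain f where f: "\<And>\<Gamma>. \<Gamma> \<in> set S \<Longrightarrow> f \<Gamma> \<in> A \<and> {fst (f \<Gamma>), snd (f \<Gamma>)} \<subseteq> \<Gamma>"
    by metis
  \<comment> \<open>Ogroups cannot be discarded by the rules, so only the allocations actually used are kept.\<close>
  define B where "B = f ` set S"
  have sub: "B \<subseteq> A" using f by (auto simp: B_def)
  have B: "x < length Ls \<and> y < length Ls \<and> (\<exists>p. Ls ! x = Neg p \<and> Ls ! y = Pos p)"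
    if "(x, y) \<in> B" for x y
    using A(2) that sub by blast
  have "B \<subseteq> {..<length Ls} \<times> {..<length Ls}" by (auto dest: B)
  moreover have "\<forall>(x, y) \<in> B. \<exists>p. Ls ! x = Neg p \<and> Ls ! y = Pos p" by (auto dest: B)
  moreover have "monogamous B"
    using A(1) sub unfolding monogamous_def by (meson subsetD)
  ultimately obtain T where T: "set T = (\<lambda>(x, y). {x, y}) ` B" "CL5 (T, map Lit Ls)"
    using CL5_allocations[of B Ls] by blast
  \<comment> \<open>Unlike \<open>T\<close>, this list runs parallel to \<open>S\<close> and repeats
    a pair chosen for several ogroups, so it can be enlarged entry by entry.\<close>
  let ?U = "map (\<lambda>\<Gamma>. {fst (f \<Gamma>), snd (f \<Gamma>)}) S"
  have "set T = set ?U" unfolding T(1) B_def by (auto simp: case_prod_beta image_image)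
  then have "CL5 ([] @ ?U, map Lit Ls)" using CL5_set_groups[OF T(2)] by simp
  moreover have "list_all2 (\<subseteq>) ?U S" using f by (auto simp: list_all2_conv_all_nth)
  ultimately have "CL5 ([] @ S, map Lit Ls)"
    using wf by (intro CL5_weaken_groups[of ?U S]) (auto simp: is_cirquent_def)
  then show ?thesis by simp
qed

section \<open>Completeness by induction on the pool\<close>

text \<open>The measure ignores the structure: a conjunction step can double the number of ogroups,
  but every step deletes one connective from the pool.\<close>

lemma trivial_CL5:
  "is_cirquent (S, Fs) \<Longrightarrow> trivial_cirquent (S, Fs) \<Longrightarrow> CL5 (S, Fs)"
proof (induction "sum_list (map size Fs)" arbitrary: S Fs rule: less_induct)
  case less
  show ?case
  proof (cases "\<forall>F \<in> set Fs. \<exists>L. F = Lit L")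
    case True
    then obtain Ls where "Fs = map Lit Ls" using ex_map_conv[of Fs Lit] by auto
    then show ?thesis using CL5_literals less.prems by blast
  next
    case False
    then obtain H where H: "H \<in> set Fs" "\<forall>L. H \<noteq> Lit L" by auto
    then obtain As Bs where Fs: "Fs = As @ H # Bs" by (meson split_list)
    let ?n = "length As"
    show ?thesis
    proof (cases H)
      case (Lit L)
      then show ?thesis using H(2) by simp
    next
      case (Disj F G)
      let ?S = "map (vimage (merge_pos ?n)) S"
      let ?Fs = "As @ F # G # Bs"
      have "trivial_cirquent (?S, ?Fs)"
        using less.prems(2)
        by (rule trivial_cirquent_mono)
          (auto simp: Fs Disj cirquent_lits_def cirquent_true_def group_true_disj)
      moreover have "is_cirquent (?S, ?Fs)"
        using less.prems(1) merge_pos_vimage_bound[of _ "length Fs" ?n]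
        by (auto simp: is_cirquent_def Fs)
      ultimately have "CL5 (?S, ?Fs)"
        by (intro less.hyps) (auto simp: Fs Disj)
      from disj_intro[OF this] show ?thesis
        by (simp add: comp_def merge_pos_surj Fs Disj del: image_vimage_eq)
    next
      case (Conj F G)
      let ?S = "concat (map (split_group ?n) S)"
      let ?Fs = "As @ F # G # Bs"
      have "trivial_cirquent (?S, ?Fs)"
        using less.prems(2)
        by (rule trivial_cirquent_mono)
          (auto simp: Fs Conj cirquent_lits_def cirquent_true_def group_true_conj)
      moreover have "\<Delta> \<subseteq> {..<length ?Fs}" if \<Delta>: "\<Delta> \<in> set ?S" for \<Delta>
      proof -
        obtain \<Gamma> where \<Gamma>: "\<Gamma> \<in> set S" "\<Delta> \<in> set (split_group ?n \<Gamma>)" using \<Delta> by auto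
        have "\<Delta> \<subseteq> merge_pos ?n -` \<Gamma>"
          using \<Gamma>(2) by (auto simp: split_group_def split: if_splits)
        also have "\<dots> \<subseteq> {..<length ?Fs}"
          using less.prems(1) \<Gamma>(1) merge_pos_vimage_bound[of \<Gamma> "length Fs" ?n]
          by (simp add: is_cirquent_def Fs)
        finally show ?thesis .
      qed
      then have "is_cirquent (?S, ?Fs)" unfolding is_cirquent_def fst_conv snd_conv by blast
      ultimately have "CL5 (?S, ?Fs)"
        by (intro less.hyps) (auto simp: Fs Conj)
      from conj_intro[OF this conj_ready_split] show ?thesis
        by (simp add: unite_pairs_split comp_def merge_pos_surj Fs Conj del: image_vimage_eq)
    qed
  qed
qed

theorem theorem8p13:
  assumes "infinite (UNIV :: 'a set)"
  shows "(\<forall>C :: 'a cirquent. is_cirquent C \<longrightarrow> (CL5 C \<longleftrightarrow> trivial_cirquent C)) \<and>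
         (\<forall>F :: 'a form. CL5 (form_cirquent F) \<longleftrightarrow> trivial_cirquent (form_cirquent F))"
proof -
  have "CL5 C \<longleftrightarrow> trivial_cirquent C" if "is_cirquent C" for C :: "'a cirquent"
    using that CL5_binary_tautology binary_tautology_trivial trivial_CL5 by (metis prod.collapse)
  moreover have "is_cirquent (form_cirquent F)" for F :: "'a form"
    by (simp add: is_cirquent_def form_cirquent_def)
  ultimately show ?thesis by blast
qed

end
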